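(* Let $f:\{0,1\}^n\to\mathbb{R}$ be a Boolean multilinear function $f(x):=\sum_{k\in[K]}a_k\prod_{j\in A_k}x_j$ with $K$ multilinear terms, where $a_k\in\mathbb{R}$ and $A_k\subseteq[n]$. Write $f=f_1-f_2$, where $$f_1(x):=\sum_{k\in[K],\,a_k<0}a_k\prod_{j\in A_k}x_j,\qquad f_2(x):=-\sum_{k\in[K],\,a_k>0}a_k\prod_{j\in A_k}x_j .$$ Then $f_1$ and $f_2$ are submodular over $\{0,1\}^n$.
   Context: $[n]=\{1,\dots,n\}$ and $[K]=\{1,\dots,K\}$. A function $g:\{0,1\}^n\to\mathbb{R}$ is submodular if $g(x)+g(y)\ge g(x\vee y)+g(x\wedge y)$ for all $x,y\in\{0,1\}^n$, where $\vee,\wedge$ are componentwise max and min. *)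

theory Defs
  imports Complex_Main "HOL-Library.FuncSet"
begin

(* Points of the cube are real-valued, so that they can be multiplied with the coefficients of a
   multilinear function, and extensional (undefined outside {1..n}), so that each point of
   {0,1}^n has exactly one representative. *)
definition cube :: "nat \<Rightarrow> (nat \<Rightarrow> real) set" where
  "cube n = {1..n} \<rightarrow>\<^sub>E {0, 1}"

definition vmax :: "nat \<Rightarrow> (nat \<Rightarrow> real) \<Rightarrow> (nat \<Rightarrow> real) \<Rightarrow> (nat \<Rightarrow> real)" where
  "vmax n x y = (\<lambda>j\<in>{1..n}. max (x j) (y j))"

definition vmin :: "nat \<Rightarrow> (nat \<Rightarrow> real) \<Rightarrow> (nat \<Rightarrow> real) \<Rightarrow> (nat \<Rightarrow> real)" where
  "vmin n x y = (\<lambda>j\<in>{1..n}. min (x j) (y j))"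

lemma vmax_in_cube: "x \<in> cube n \<Longrightarrow> y \<in> cube n \<Longrightarrow> vmax n x y \<in> cube n"
  by (fastforce simp: cube_def vmax_def max_def PiE_iff)

lemma vmin_in_cube: "x \<in> cube n \<Longrightarrow> y \<in> cube n \<Longrightarrow> vmin n x y \<in> cube n"
  by (fastforce simp: cube_def vmin_def min_def PiE_iff)

definition submodular :: "nat \<Rightarrow> ((nat \<Rightarrow> real) \<Rightarrow> real) \<Rightarrow> bool" where
  "submodular n g \<longleftrightarrow>
     (\<forall>x\<in>cube n. \<forall>y\<in>cube n. g x + g y \<ge> g (vmax n x y) + g (vmin n x y))"

end

theory Submission
  imports Defs
begin

text \<open>On the cube a monomial is the indicator of ``all coordinates in \<open>S\<close> equal \<open>1\<close>''. It is
  therefore monotone, and it turns componentwise minima into products. For values \<open>p\<close>, \<open>q\<close> in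
  \<open>{0, 1}\<close> this gives \<open>p + q = max p q + p * q\<close>, where monotonicity bounds the first summand by
  the value at the join and the second one is the value at the meet: monomials are supermodular
  (\<open>monomial_supermodular\<close>). Multiplication by a nonpositive coefficient reverses the inequality and
  sums preserve it (\<open>submodular_nonpos_combination\<close>). Both parts of the decomposition are
  combinations of monomials with negative coefficients, the second one because of the sign in
  front of its sum.\<close>

lemma monomial_supermodular:
  assumes "S \<subseteq> {1..n}" "x \<in> cube n" "y \<in> cube n"
  shows "(\<Prod>j\<in>S. x j) + (\<Prod>j\<in>S. y j) \<le> (\<Prod>j\<in>S. vmax n x y j) + (\<Prod>j\<in>S. vmin n x y j)"
proof -
  let ?P = "\<lambda>z :: nat \<Rightarrow> real. \<Prod>j\<in>S. z j"
  have binary: "x j \<in> {0, 1}" "y j \<in> {0, 1}" if "j \<in> S" for j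
    using assms that by (auto simp: cube_def PiE_iff)
  have zero_or_one: "?P z \<in> {0, 1}" if "\<And>j. j \<in> S \<Longrightarrow> z j \<in> {0, 1}" for z
  proof (cases "\<exists>j\<in>S. z j = 0")
    case True
    then show ?thesis using finite_subset[OF assms(1)] by auto
  next
    case False
    then have "?P z = 1" using that by (intro prod.neutral) auto
    then show ?thesis by simp
  qed
  have "x j \<le> vmax n x y j" "y j \<le> vmax n x y j" if "j \<in> S" for j
    using assms(1) that by (auto simp: vmax_def)
  then have join: "?P x \<le> ?P (vmax n x y)" "?P y \<le> ?P (vmax n x y)"
    using binary by (force intro!: prod_mono)+
  have "vmin n x y j = x j * y j" if "j \<in> S" for j
    using assms(1) that binary[OF that] by (auto simp: vmin_def)
  then have meet: "?P (vmin n x y) = ?P x * ?P y"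
    by (simp add: prod.distrib)
  show ?thesis
    using zero_or_one[of x] zero_or_one[of y] binary join unfolding meet by auto
qed

lemma submodular_nonpos_combination:
  assumes vars: "\<And>k. k \<in> I \<Longrightarrow> A k \<subseteq> {1..n}"
    and nonpos: "\<And>k. k \<in> I \<Longrightarrow> c k \<le> 0"
    and g: "\<And>x. x \<in> cube n \<Longrightarrow> g x = (\<Sum>k\<in>I. c k * (\<Prod>j\<in>A k. x j))"
  shows "submodular n g"
  unfolding submodular_def
proof (intro ballI)
  fix x y assume xy: "x \<in> cube n" "y \<in> cube n"
  let ?P = "\<lambda>k (z :: nat \<Rightarrow> real). \<Prod>j\<in>A k. z j"
  have "g (vmax n x y) + g (vmin n x y) = (\<Sum>k\<in>I. c k * (?P k (vmax n x y) + ?P k (vmin n x y)))"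
    using xy by (simp add: g vmax_in_cube vmin_in_cube sum.distrib distrib_left)
  also have "\<dots> \<le> (\<Sum>k\<in>I. c k * (?P k x + ?P k y))"
    using xy by (intro sum_mono mult_left_mono_neg monomial_supermodular vars nonpos)
  also have "\<dots> = g x + g y"
    using xy by (simp add: g sum.distrib distrib_left)
  finally show "g (vmax n x y) + g (vmin n x y) \<le> g x + g y" .
qed

theorem proposition9:
  fixes n K :: nat
    and a :: "nat \<Rightarrow> real"
    and A :: "nat \<Rightarrow> nat set"
    and f f1 f2 :: "(nat \<Rightarrow> real) \<Rightarrow> real"
  assumes "\<And>k. k \<in> {1..K} \<Longrightarrow> A k \<subseteq> {1..n}"
    and "\<And>x. x \<in> cube n \<Longrightarrow> f x = (\<Sum>k\<in>{1..K}. a k * (\<Prod>j\<in>A k. x j))"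
    and "\<And>x. x \<in> cube n \<Longrightarrow> f1 x = (\<Sum>k\<in>{k\<in>{1..K}. a k < 0}. a k * (\<Prod>j\<in>A k. x j))"
    and "\<And>x. x \<in> cube n \<Longrightarrow> f2 x = - (\<Sum>k\<in>{k\<in>{1..K}. a k > 0}. a k * (\<Prod>j\<in>A k. x j))"
  shows "(\<forall>x\<in>cube n. f x = f1 x - f2 x) \<and> submodular n f1 \<and> submodular n f2"
proof (intro conjI ballI)
  fix x assume x: "x \<in> cube n"
  let ?t = "\<lambda>k. a k * (\<Prod>j\<in>A k. x j)"
  let ?N = "{k\<in>{1..K}. a k < 0}" and ?P = "{k\<in>{1..K}. a k > 0}"
  \<comment> \<open>Indices with coefficient \<open>0\<close> lie in neither part, but their terms vanish.\<close>
  have "sum ?t {1..K} = sum ?t (?N \<union> ?P)"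
    by (rule sum.mono_neutral_right) auto
  also have "\<dots> = sum ?t ?N + sum ?t ?P"
    by (rule sum.union_disjoint) auto
  finally show "f x = f1 x - f2 x"
    using x by (simp add: assms(2-4))
next
  show "submodular n f1"
    by (rule submodular_nonpos_combination[OF _ _ assms(3)]) (use assms(1) in auto)
  have "f2 x = (\<Sum>k\<in>{k\<in>{1..K}. a k > 0}. - a k * (\<Prod>j\<in>A k. x j))" if "x \<in> cube n" for x
    using that by (simp add: assms(4) sum_negf)
  then show "submodular n f2"
    by (rule submodular_nonpos_combination[rotated 2]) (use assms(1) in auto)
qed

end
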